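(* For every compact ultrametric space $(X,\mathrm{d})$, there exists a finite approximative sequence (FAS) $\{U_{2\varepsilon_n}(A_n),p_{n,n+1}\}_{n\in\mathbb{N}}$ of $X$ whose inverse limit $\mathcal{X}$ is homeomorphic to $X$.
   Context: An ultrametric space is a metric space satisfying $\mathrm{d}(x,y)\leq\max\{\mathrm{d}(x,z),\mathrm{d}(y,z)\}$ for all $x,y,z$. Let $(X,\mathrm{d})$ be a compact metric space. Hyperspaces: $2^X$ is the set of non-empty closed subsets of $X$. The upper semifinite topology on $2^X$ has as base the sets $B(U)=\{C\in 2^X: C\subset U\}$, $U\subset X$ open; the resulting space is $2^X_u$. If $A\subset X$ is finite and non-empty, $2^A_u$ is the (finite) set of non-empty subsets of $A$ with the upper semifinite topology, i.e. the topology with base the sets $2^C=\{D: \emptyset\neq D\subset C\}$, $\emptyset\ne C\subset A$. For $\varepsilon>0$, $U_{2\varepsilon}(A)=\{C\in 2^A:\operatorname{diam}(C)<2\varepsilon\}\subset 2^A_u$ with the subspace topology. Approximations: A finite subset $A\subset X$ is a finite $\varepsilon$-approximation of $X$ if for every $x\in X$ there is $a\in A$ with $\mathrm{d}(x,a)<\varepsilon$. For $x\in X$ put $A(x)=\{a\in A:\mathrm{d}(x,a)=\mathrm{d}(x,A)\}$ and, for $C\in 2^X$, $r_A(C)=\bigcup_{c\in C}A(c)$. If $A$ is a finite $\varepsilon$-approximation, let $\gamma=\sup\{\mathrm{d}(x,A):x\in X\}$ (so $\gamma<\varepsilon$). A number $0<\varepsilon'<\varepsilon$ is adjusted to $A$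 if $\varepsilon'<\frac{\varepsilon-\gamma}{2}$. In that case, for every finite $\varepsilon'$-approximation $A'$, the map $p:U_{2\varepsilon'}(A')\to U_{2\varepsilon}(A)$, $p(C)=r_A(C)$, is well defined and continuous. FAS: A finite approximative sequence of $X$ is an inverse sequence $\{U_{2\varepsilon_n}(A_n),p_{n,n+1}\}_{n\in\mathbb{N}}$ (with $n\geq 1$), where $\{\varepsilon_n\}$ is a sequence of positive reals converging to zero, each $A_n$ is a finite $\varepsilon_n$-approximation of $X$, $\varepsilon_{n+1}$ is adjusted to $A_n$ for every $n$, and $p_{n,n+1}:U_{2\varepsilon_{n+1}}(A_{n+1})\to U_{2\varepsilon_n}(A_n)$ is $p_{n,n+1}(C)=r_{A_n}(C)$. Its inverse limit $\mathcal{X}$ is the subspace of $\prod_n U_{2\varepsilon_n}(A_n)$ of sequences $\{C_n\}$ with $p_{n,n+1}(C_{n+1})=C_n$ for all $n$. *)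

theory Defs
  imports "HOL-Analysis.Analysis"
begin

text \<open>A metric space is given as a subset X of a type of class \<^class>\<open>metric_space\<close>,
  with the restricted distance and the subspace topology \<^term>\<open>top_of_set X\<close>.\<close>

definition ultrametric_on :: "'a::metric_space set \<Rightarrow> bool" where
  "ultrametric_on X \<longleftrightarrow>
     (\<forall>x\<in>X. \<forall>y\<in>X. \<forall>z\<in>X. dist x y \<le> max (dist x z) (dist y z))"

definition finite_hyperspace_base :: "'a set \<Rightarrow> 'a set set \<Rightarrow> bool" where
  "finite_hyperspace_base A B \<longleftrightarrow>
     (\<exists>C. C \<noteq> {} \<and> C \<subseteq> A \<and> B = {D. D \<noteq> {} \<and> D \<subseteq> C})"

definition finite_hyperspace :: "'a set \<Rightarrow> 'a set topology" where
  "finite_hyperspace A = topology (arbitrary union_of (finite_hyperspace_base A))"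

text \<open>The sets above do form a base, so the use of \<^const>\<open>topology\<close> is meaningful.\<close>

lemma openin_finite_hyperspace:
  "openin (finite_hyperspace A) = arbitrary union_of (finite_hyperspace_base A)"
proof -
  have *: "(arbitrary union_of (finite_hyperspace_base A)) (S \<inter> T)"
    if S: "finite_hyperspace_base A S" and T: "finite_hyperspace_base A T" for S T
  proof -
    obtain C where C: "C \<subseteq> A" "S = {D. D \<noteq> {} \<and> D \<subseteq> C}"
      using S unfolding finite_hyperspace_base_def by (elim exE conjE)
    obtain C' where C': "T = {D. D \<noteq> {} \<and> D \<subseteq> C'}"
      using T unfolding finite_hyperspace_base_def by (elim exE conjE)
    have eq: "S \<inter> T = {D. D \<noteq> {} \<and> D \<subseteq> C \<inter> C'}"
      unfolding C(2) C' by auto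
    show ?thesis
    proof (cases "C \<inter> C' = {}")
      case True
      then have "S \<inter> T = {}"
        unfolding eq by auto
      then show ?thesis
        by (simp only: arbitrary_union_of_empty)
    next
      case False
      moreover have "C \<inter> C' \<subseteq> A"
        using C(1) by auto
      ultimately have "finite_hyperspace_base A (S \<inter> T)"
        unfolding finite_hyperspace_base_def eq by (intro exI [of _ "C \<inter> C'"] conjI refl)
      then show ?thesis
        by (rule arbitrary_union_of_inc)
    qed
  qed
  have "istopology (arbitrary union_of (finite_hyperspace_base A))"
    unfolding istopology_base_eq by (intro allI impI, elim conjE) (rule *)
  then show ?thesis
    unfolding finite_hyperspace_def by (rule topology_inverse')
qed

lemma topspace_finite_hyperspace:
  "topspace (finite_hyperspace A) = {D. D \<noteq> {} \<and> D \<subseteq> A}"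
proof
  obtain \<U> where \<U>: "\<And>B. B \<in> \<U> \<Longrightarrow> finite_hyperspace_base A B"
    and eq: "\<Union>\<U> = topspace (finite_hyperspace A)"
    using openin_topspace [of "finite_hyperspace A"]
    unfolding openin_finite_hyperspace union_of_def by auto
  have "B \<subseteq> {D. D \<noteq> {} \<and> D \<subseteq> A}" if "B \<in> \<U>" for B
    using \<U> [OF that] unfolding finite_hyperspace_base_def by auto
  then show "topspace (finite_hyperspace A) \<subseteq> {D. D \<noteq> {} \<and> D \<subseteq> A}"
    unfolding eq [symmetric] by (rule Union_least)
  show "{D. D \<noteq> {} \<and> D \<subseteq> A} \<subseteq> topspace (finite_hyperspace A)"
  proof (cases "A = {}")
    case False
    then have "finite_hyperspace_base A {D. D \<noteq> {} \<and> D \<subseteq> A}"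
      unfolding finite_hyperspace_base_def by (intro exI [of _ A] conjI refl subset_refl)
    then have "openin (finite_hyperspace A) {D. D \<noteq> {} \<and> D \<subseteq> A}"
      unfolding openin_finite_hyperspace by (rule arbitrary_union_of_inc)
    then show ?thesis
      by (rule openin_subset)
  qed auto
qed

text \<open>In the notation \<open>U\<^sub>2\<^sub>\<epsilon>(A)\<close>, the first argument below is the radius \<open>2\<epsilon>\<close>.\<close>

definition small_sets :: "real \<Rightarrow> 'a::metric_space set \<Rightarrow> 'a set topology" where
  "small_sets \<delta> A =
     subtopology (finite_hyperspace A) {C. C \<noteq> {} \<and> C \<subseteq> A \<and> diameter C < \<delta>}"

definition finite_approximation ::
    "'a::metric_space set \<Rightarrow> real \<Rightarrow> 'a set \<Rightarrow> bool" where
  "finite_approximation X \<epsilon> A \<longleftrightarrow>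
     finite A \<and> A \<subseteq> X \<and> (\<forall>x\<in>X. \<exists>a\<in>A. dist x a < \<epsilon>)"

definition nearest_points :: "'a::metric_space set \<Rightarrow> 'a \<Rightarrow> 'a set" where
  "nearest_points A x = {a \<in> A. dist x a = infdist x A}"

definition nearest_map :: "'a::metric_space set \<Rightarrow> 'a set \<Rightarrow> 'a set" where
  "nearest_map A C = (\<Union>c\<in>C. nearest_points A c)"

text \<open>As for \<^const>\<open>infdist\<close> and \<^const>\<open>diameter\<close>, the value on the empty space is set to 0
  (the supremum of the empty set in the non-negative reals), since \<^const>\<open>Sup\<close> on the
  reals is unspecified there.\<close>

definition covering_radius :: "'a::metric_space set \<Rightarrow> 'a set \<Rightarrow> real" where
  "covering_radius X A = (if X = {} then 0 else SUP x\<in>X. infdist x A)"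

definition adjusted :: "'a::metric_space set \<Rightarrow> real \<Rightarrow> 'a set \<Rightarrow> real \<Rightarrow> bool" where
  "adjusted X \<epsilon> A \<epsilon>' \<longleftrightarrow> 0 < \<epsilon>' \<and> \<epsilon>' < \<epsilon> \<and> \<epsilon>' < (\<epsilon> - covering_radius X A) / 2"

text \<open>A finite approximative sequence is determined by the data \<open>\<epsilon>\<^sub>n\<close>, \<open>A\<^sub>n\<close> for \<open>n \<ge> 1\<close>: its
  terms are \<open>small_sets (2 * \<epsilon> n) (A n)\<close> and its bonding maps are \<open>nearest_map (A n)\<close>.
  Values at index 0 are irrelevant.\<close>

definition finite_approximative_sequence ::
    "'a::metric_space set \<Rightarrow> (nat \<Rightarrow> real) \<Rightarrow> (nat \<Rightarrow> 'a set) \<Rightarrow> bool" where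
  "finite_approximative_sequence X \<epsilon> A \<longleftrightarrow>
     (\<forall>n\<ge>1. 0 < \<epsilon> n) \<and> \<epsilon> \<longlonglongrightarrow> 0 \<and>
     (\<forall>n\<ge>1. finite_approximation X (\<epsilon> n) (A n)) \<and>
     (\<forall>n\<ge>1. adjusted X (\<epsilon> n) (A n) (\<epsilon> (Suc n)))"

definition FAS_inverse_limit ::
    "(nat \<Rightarrow> real) \<Rightarrow> (nat \<Rightarrow> 'a::metric_space set) \<Rightarrow> (nat \<Rightarrow> 'a set) topology" where
  "FAS_inverse_limit \<epsilon> A =
     subtopology (product_topology (\<lambda>n. small_sets (2 * \<epsilon> n) (A n)) {1..})
       {C. \<forall>n\<ge>1. nearest_map (A n) (C (Suc n)) = C n}"

end

theory Submission
  imports Defs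
begin

text \<open>
  In an ultrametric space the relation \<open>dist x y < \<delta>\<close> is an equivalence, and on a compact space
  it has finitely many classes. Let \<open>A\<^sub>n\<close> contain exactly one point of every class for
  \<open>\<delta> = \<epsilon>\<^sub>n\<close>. The set \<open>A\<^sub>n\<close> may well contain pairs of points at distance less than
  \<open>2\<epsilon>\<^sub>n\<close>, so the space \<open>U\<^sub>2\<^sub>\<epsilon>(A)\<close> need not be discrete for \<open>\<epsilon> = \<epsilon>\<^sub>n\<close> and
  \<open>A = A\<^sub>n\<close>. The inverse limit does not see those pairs: adjustedness gives
  \<open>2\<epsilon>\<^sub>n\<^sub>+\<^sub>1 < \<epsilon>\<^sub>n\<close>, so each member of the next space lies in a single class at level \<open>n\<close>, and
  the bonding map collapses it to the representative of that class
  (\<open>nearest_map_transversal\<close>). Hence every term of a thread is a singleton, which is an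
  isolated point of its space because no proper non-empty subset lies below it, and a thread
  amounts to a decreasing sequence of balls of radius \<open>\<epsilon>\<^sub>n\<close> (\<open>thread_singleton\<close>).

  Sending a point to the representatives of its classes is therefore a map from \<open>X\<close> to the limit.
  It is continuous because it is locally constant in each coordinate, injective because
  \<open>\<epsilon>\<^sub>n\<close> tends to 0, and surjective because the points of a thread form a Cauchy sequence.
  A continuous bijection from a compact space to a Hausdorff space is a homeomorphism
  (\<open>FAS_inverse_limit_homeomorphic\<close>). Suitable \<open>\<epsilon>\<^sub>n\<close> are chosen recursively, since the
  covering radius of a finite approximation of a compact space is strictly below the given bound.
\<close>

section \<open>Transversals of the ball partition\<close>

definition ball_transversal :: "'a::metric_space set \<Rightarrow> real \<Rightarrow> 'a set \<Rightarrow> bool" where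
  "ball_transversal X \<delta> A \<longleftrightarrow> finite A \<and> A \<subseteq> X \<and> (\<forall>x\<in>X. \<exists>!a. a \<in> A \<and> dist x a < \<delta>)"

definition representative :: "real \<Rightarrow> 'a::metric_space set \<Rightarrow> 'a \<Rightarrow> 'a" where
  "representative \<delta> A x = (THE a. a \<in> A \<and> dist x a < \<delta>)"

lemma ultrametric_on_dist_less:
  assumes "ultrametric_on X" "x \<in> X" "y \<in> X" "z \<in> X" "dist x y < \<delta>" "dist y z < \<delta>"
  shows "dist x z < \<delta>"
proof -
  have "dist x z \<le> max (dist x y) (dist z y)"
    using assms unfolding ultrametric_on_def by blast
  then show ?thesis
    using assms(5,6) by (simp add: dist_commute)
qed

lemma representative:
  assumes "ball_transversal X \<delta> A" "x \<in> X"
  shows "representative \<delta> A x \<in> A" "dist x (representative \<delta> A x) < \<delta>"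
proof -
  have "\<exists>!a. a \<in> A \<and> dist x a < \<delta>"
    using assms unfolding ball_transversal_def by blast
  from theI' [OF this]
  show "representative \<delta> A x \<in> A" "dist x (representative \<delta> A x) < \<delta>"
    unfolding representative_def by auto
qed

lemma representative_unique:
  assumes "ball_transversal X \<delta> A" "x \<in> X" "a \<in> A" "dist x a < \<delta>"
  shows "representative \<delta> A x = a"
  using assms representative [OF assms(1,2)] unfolding ball_transversal_def by blast

lemma representative_eq:
  assumes "ultrametric_on X" "ball_transversal X \<delta> A" "x \<in> X" "y \<in> X" "dist x y < \<delta>"
  shows "representative \<delta> A x = representative \<delta> A y"
proof (rule representative_unique [OF assms(2,3)])
  show "representative \<delta> A y \<in> A"
    using representative [OF assms(2,4)] by blast
  then have "representative \<delta> A y \<in> X"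
    using assms(2) unfolding ball_transversal_def by blast
  then show "dist x (representative \<delta> A y) < \<delta>"
    using ultrametric_on_dist_less assms representative [OF assms(2,4)] by blast
qed

lemma ball_transversal_finite_approximation:
  "ball_transversal X \<delta> A \<Longrightarrow> finite_approximation X \<delta> A"
  unfolding ball_transversal_def finite_approximation_def by blast

lemma ball_transversal_exists:
  fixes X :: "'a::metric_space set"
  assumes "compact X" "ultrametric_on X" "0 < \<delta>"
  shows "\<exists>A. ball_transversal X \<delta> A"
proof -
  \<comment> \<open>Choosing from the class of \<open>x\<close>, as a set, makes \<open>r\<close> take equal values on equivalent points.\<close>
  define r where "r x = (SOME y. y \<in> {y \<in> X. dist x y < \<delta>})" for x
  have r: "r x \<in> X" "dist x (r x) < \<delta>" if "x \<in> X" for x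
  proof -
    have "x \<in> {y \<in> X. dist x y < \<delta>}"
      using that \<open>0 < \<delta>\<close> by simp
    then have "r x \<in> {y \<in> X. dist x y < \<delta>}"
      unfolding r_def by (rule someI)
    then show "r x \<in> X" "dist x (r x) < \<delta>" by auto
  qed
  have r_eq: "r x = r y" if "x \<in> X" "y \<in> X" "dist x y < \<delta>" for x y
  proof -
    have "dist y x < \<delta>"
      using that by (simp add: dist_commute)
    then have "{z \<in> X. dist x z < \<delta>} = {z \<in> X. dist y z < \<delta>}"
      using ultrametric_on_dist_less [OF assms(2)] that by blast
    then show ?thesis
      unfolding r_def by simp
  qed
  obtain K where K: "finite K" "K \<subseteq> X" "X \<subseteq> (\<Union>k\<in>K. ball k \<delta>)"
    using compactE_image [OF assms(1), of X "\<lambda>k. ball k \<delta>"] assms(3)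
    by (metis (no_types, lifting) UN_I centre_in_ball open_ball subsetI)
  have "r ` X \<subseteq> r ` K"
  proof
    fix a assume "a \<in> r ` X"
    then obtain x where x: "x \<in> X" "a = r x" by blast
    then obtain k where k: "k \<in> K" "dist k x < \<delta>"
      using K(3) by auto
    then have "r k = r x"
      using r_eq K(2) x(1) by blast
    then show "a \<in> r ` K"
      using imageI [OF k(1), of r] x(2) by simp
  qed
  then have "finite (r ` X)"
    using K(1) finite_surj by blast
  moreover have "r ` X \<subseteq> X"
    using r by blast
  moreover have "\<exists>!a. a \<in> r ` X \<and> dist x a < \<delta>" if "x \<in> X" for x
  proof (rule ex1I [of _ "r x"])
    show "r x \<in> r ` X \<and> dist x (r x) < \<delta>"
      using r that by blast
    fix a assume "a \<in> r ` X \<and> dist x a < \<delta>"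
    then obtain y where y: "y \<in> X" "a = r y" "dist x (r y) < \<delta>" by blast
    have "r x = r (r y)"
      using r_eq r that y by blast
    also have "\<dots> = r y"
      using r_eq [of y "r y"] r y by simp
    finally show "a = r x"
      using y by simp
  qed
  ultimately have "ball_transversal X \<delta> (r ` X)"
    unfolding ball_transversal_def by (intro conjI ballI)
  then show ?thesis ..
qed

lemma nearest_points_transversal:
  assumes "ball_transversal X \<delta> A" "x \<in> X"
  shows "nearest_points A x = {representative \<delta> A x}"
proof -
  let ?r = "representative \<delta> A x"
  have least: "dist x ?r \<le> dist x a" if "a \<in> A" for a
    using representative [OF assms] representative_unique [OF assms that]
    by (cases "dist x a < \<delta>") auto
  have "A \<noteq> {}"
    using representative [OF assms] by blast
  have "infdist x A = dist x ?r"
  proof (rule antisym)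
    show "infdist x A \<le> dist x ?r"
      using representative [OF assms] by (intro infdist_le) blast
    show "dist x ?r \<le> infdist x A"
      unfolding infdist_notempty [OF \<open>A \<noteq> {}\<close>]
      using \<open>A \<noteq> {}\<close> least by (intro cINF_greatest)
  qed
  then have eq: "nearest_points A x = {a \<in> A. dist x a = dist x ?r}"
    unfolding nearest_points_def by simp
  show ?thesis
    unfolding eq
  proof (intro equalityI subsetI)
    fix a assume "a \<in> {a \<in> A. dist x a = dist x ?r}"
    then have "a \<in> A" "dist x a < \<delta>"
      using representative(2) [OF assms] by simp_all
    then show "a \<in> {?r}"
      using representative_unique [OF assms] by blast
  qed (use representative(1) [OF assms] in simp)
qed

text \<open>This collapse is what makes the bonding maps blind to the non-singleton members of the
  spaces in the sequence: a set of diameter below \<open>\<delta>\<close> lies in one class.\<close>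

lemma nearest_map_transversal:
  assumes "ultrametric_on X" "ball_transversal X \<delta> A"
    and "C \<subseteq> X" "bounded C" "diameter C < \<delta>" "c \<in> C"
  shows "nearest_map A C = {representative \<delta> A c}"
proof -
  have "nearest_points A d = {representative \<delta> A c}" if "d \<in> C" for d
  proof -
    have "dist d c < \<delta>"
      using diameter_bounded_bound [OF assms(4) that assms(6)] assms(5) by simp
    then have "representative \<delta> A d = representative \<delta> A c"
      using representative_eq [OF assms(1,2)] assms(3,6) that by blast
    then show ?thesis
      using nearest_points_transversal [OF assms(2)] assms(3) that by auto
  qed
  then show ?thesis
    using assms(6) unfolding nearest_map_def by auto
qed

section \<open>Covering radii\<close>

lemma infdist_le_covering_radius:
  assumes "compact X" "x \<in> X"
  shows "infdist x A \<le> covering_radius X A"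
proof -
  have "compact ((\<lambda>x. infdist x A) ` X)"
    using assms(1) by (intro compact_continuous_image continuous_intros)
  then have "bdd_above ((\<lambda>x. infdist x A) ` X)"
    by (intro bounded_imp_bdd_above compact_imp_bounded)
  then show ?thesis
    using assms(2) cSUP_upper [of x X "\<lambda>x. infdist x A"] unfolding covering_radius_def by auto
qed

lemma covering_radius_nonneg:
  assumes "compact X"
  shows "0 \<le> covering_radius X A"
proof (cases "X = {}")
  case False
  then obtain x where "x \<in> X" by blast
  then show ?thesis
    using infdist_le_covering_radius [OF assms] infdist_nonneg order_trans by blast
qed (simp add: covering_radius_def)

text \<open>Strictness, which leaves room for an adjusted number, holds because the supremum is
  attained.\<close>

lemma covering_radius_less:
  assumes "compact X" "finite_approximation X \<delta> A" "0 < \<delta>"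
  shows "covering_radius X A < \<delta>"
proof (cases "X = {}")
  case False
  obtain x where x: "x \<in> X" "\<forall>y\<in>X. infdist y A \<le> infdist x A"
    using continuous_attains_sup [OF assms(1) False
        continuous_on_infdist [OF continuous_on_id], of A] by auto
  obtain a where a: "a \<in> A" "dist x a < \<delta>"
    using assms(2) x(1) unfolding finite_approximation_def by blast
  have "covering_radius X A \<le> infdist x A"
    using False x(2) unfolding covering_radius_def by (auto intro: cSUP_least)
  also have "\<dots> \<le> dist x a"
    using a(1) by (rule infdist_le)
  finally show ?thesis
    using a(2) by simp
qed (simp add: covering_radius_def assms(3))

section \<open>The inverse limit over transversals\<close>

lemma topspace_small_sets:
  "topspace (small_sets \<delta> A) = {C. C \<noteq> {} \<and> C \<subseteq> A \<and> diameter C < \<delta>}"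
  unfolding small_sets_def by (auto simp: topspace_finite_hyperspace)

text \<open>The only non-empty subset of a singleton is the singleton itself, so the basic open set
  \<open>2\<^sup>C\<close> of \<open>C = {a}\<close> has one element.\<close>

lemma openin_small_sets_singleton:
  assumes "a \<in> A" "0 < \<delta>"
  shows "openin (small_sets \<delta> A) {{a}}"
proof -
  have "finite_hyperspace_base A {{a}}"
    unfolding finite_hyperspace_base_def using assms(1) by (intro exI [of _ "{a}"]) auto
  then have "openin (finite_hyperspace A) {{a}}"
    unfolding openin_finite_hyperspace by (rule arbitrary_union_of_inc)
  moreover have "{{a}} = {{a}} \<inter> {C. C \<noteq> {} \<and> C \<subseteq> A \<and> diameter C < \<delta>}"
    using assms by auto
  ultimately show ?thesis
    unfolding small_sets_def openin_subtopology by blast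
qed

lemma topspace_FAS_inverse_limit:
  "topspace (FAS_inverse_limit \<epsilon> A) =
     {C \<in> extensional {1..}. \<forall>n\<ge>1. C n \<noteq> {} \<and> C n \<subseteq> A n \<and> diameter (C n) < 2 * \<epsilon> n
        \<and> nearest_map (A n) (C (Suc n)) = C n}"
  unfolding FAS_inverse_limit_def by (auto simp: topspace_small_sets PiE_iff extensional_def)

lemma thread_extensional: "C \<in> topspace (FAS_inverse_limit \<epsilon> A) \<Longrightarrow> C \<in> extensional {1..}"
  unfolding topspace_FAS_inverse_limit by blast

lemma continuous_map_FAS_coordinate:
  assumes "1 \<le> n"
  shows "continuous_map (FAS_inverse_limit \<epsilon> A) (small_sets (2 * \<epsilon> n) (A n)) (\<lambda>C. C n)"
  unfolding FAS_inverse_limit_def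
  using assms by (intro continuous_map_from_subtopology continuous_map_product_projection) simp

lemma adjusted_double_less:
  assumes "compact X" "adjusted X \<epsilon> A \<epsilon>'"
  shows "2 * \<epsilon>' < \<epsilon>"
  using assms(2) covering_radius_nonneg [OF assms(1), of A] unfolding adjusted_def
  by (auto simp: field_simps)

locale transversal_sequence =
  fixes X :: "'a::metric_space set" and \<epsilon> :: "nat \<Rightarrow> real" and A :: "nat \<Rightarrow> 'a set"
  assumes compact: "compact X" and ultrametric: "ultrametric_on X"
    and FAS: "finite_approximative_sequence X \<epsilon> A"
    and transversal: "\<And>n. 1 \<le> n \<Longrightarrow> ball_transversal X (\<epsilon> n) (A n)"
begin

abbreviation rep :: "nat \<Rightarrow> 'a \<Rightarrow> 'a" where
  "rep n \<equiv> representative (\<epsilon> n) (A n)"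

lemma eps_pos: "1 \<le> n \<Longrightarrow> 0 < \<epsilon> n"
  and eps_tendsto: "\<epsilon> \<longlonglongrightarrow> 0"
  and eps_Suc: "1 \<le> n \<Longrightarrow> 2 * \<epsilon> (Suc n) < \<epsilon> n"
  using FAS adjusted_double_less [OF compact]
  unfolding finite_approximative_sequence_def by blast+

lemma A_subset: "1 \<le> n \<Longrightarrow> A n \<subseteq> X"
  and A_finite: "1 \<le> n \<Longrightarrow> finite (A n)"
  using transversal unfolding ball_transversal_def by blast+

lemma rep_in: "1 \<le> n \<Longrightarrow> x \<in> X \<Longrightarrow> rep n x \<in> A n"
  and dist_rep: "1 \<le> n \<Longrightarrow> x \<in> X \<Longrightarrow> dist x (rep n x) < \<epsilon> n"
  using representative [OF transversal] by blast+

lemma eps_antimono: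
  assumes "1 \<le> n" "n \<le> m"
  shows "\<epsilon> m \<le> \<epsilon> n"
  using assms(2)
proof (induction m rule: dec_induct)
  case (step m)
  then show ?case
    using eps_Suc [of m] eps_pos [of "Suc m"] assms(1) by simp
qed simp

text \<open>The set \<open>C n\<close> is the image of \<open>C (Suc n)\<close>, whose diameter is below \<open>2 * \<epsilon> (Suc n)\<close> and
  hence below \<open>\<epsilon> n\<close>.\<close>

lemma thread_singleton:
  assumes "C \<in> topspace (FAS_inverse_limit \<epsilon> A)" "1 \<le> n" "c \<in> C (Suc n)"
  shows "C n = {rep n c}"
proof -
  have C: "C (Suc n) \<subseteq> A (Suc n)" "diameter (C (Suc n)) < 2 * \<epsilon> (Suc n)"
    "nearest_map (A n) (C (Suc n)) = C n"
    using assms(1,2) unfolding topspace_FAS_inverse_limit by auto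
  have "bounded (C (Suc n))"
    using C(1) A_finite [of "Suc n"] finite_imp_bounded finite_subset by auto
  moreover have "C (Suc n) \<subseteq> X"
    using C(1) A_subset [of "Suc n"] by auto
  moreover have "diameter (C (Suc n)) < \<epsilon> n"
    using C(2) eps_Suc [OF assms(2)] by simp
  ultimately show ?thesis
    using nearest_map_transversal [OF ultrametric transversal [OF assms(2)]] assms(3) C(3)
    by metis
qed

lemma thread_points:
  assumes "C \<in> topspace (FAS_inverse_limit \<epsilon> A)"
  obtains a where "\<And>n. 1 \<le> n \<Longrightarrow> C n = {a n}" "\<And>n. 1 \<le> n \<Longrightarrow> a n \<in> A n"
    "\<And>n. 1 \<le> n \<Longrightarrow> a n = rep n (a (Suc n))"
proof -
  have ne: "C n \<noteq> {}" "C n \<subseteq> A n" if "1 \<le> n" for n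
    using assms that unfolding topspace_FAS_inverse_limit by auto
  have "\<exists>a. C n = {a}" if n: "1 \<le> n" for n
  proof -
    obtain c where "c \<in> C (Suc n)"
      using ne(1) [of "Suc n"] by auto
    then show ?thesis
      using thread_singleton [OF assms n] by blast
  qed
  then obtain a where a: "\<And>n. 1 \<le> n \<Longrightarrow> C n = {a n}"
    by metis
  show ?thesis
  proof (rule that [OF a])
    fix n :: nat assume n: "1 \<le> n"
    show "a n \<in> A n"
      using ne(2) [OF n] a [OF n] by simp
    have "a (Suc n) \<in> C (Suc n)"
      using a [of "Suc n"] by simp
    from thread_singleton [OF assms n this] show "a n = rep n (a (Suc n))"
      using a [OF n] by simp
  qed
qed

definition thread_of :: "'a \<Rightarrow> nat \<Rightarrow> 'a set" where
  "thread_of x = (\<lambda>n\<in>{1..}. {rep n x})"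

lemma thread_of_in:
  assumes "x \<in> X"
  shows "thread_of x \<in> topspace (FAS_inverse_limit \<epsilon> A)"
proof -
  have "nearest_map (A n) {rep (Suc n) x} = {rep n x}" if n: "1 \<le> n" for n
  proof -
    have rX: "rep (Suc n) x \<in> X"
      using rep_in [of "Suc n"] A_subset [of "Suc n"] assms by auto
    have "dist (rep (Suc n) x) x < \<epsilon> n"
      using dist_rep [of "Suc n" x] eps_antimono [of n "Suc n"] n assms
      by (simp add: dist_commute)
    then have "rep n (rep (Suc n) x) = rep n x"
      using representative_eq [OF ultrametric transversal [OF n]] rX assms by blast
    then show ?thesis
      unfolding nearest_map_def using nearest_points_transversal [OF transversal [OF n] rX]
      by simp
  qed
  then show ?thesis
    using rep_in assms eps_pos unfolding topspace_FAS_inverse_limit thread_of_def by auto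
qed

lemma continuous_map_thread_of:
  "continuous_map (top_of_set X) (FAS_inverse_limit \<epsilon> A) thread_of"
proof -
  have coord: "continuous_map (top_of_set X) (small_sets (2 * \<epsilon> n) (A n)) (\<lambda>x. {rep n x})"
    if n: "1 \<le> n" for n
    unfolding continuous_map_def
  proof (intro conjI allI impI)
    show "(\<lambda>x. {rep n x}) \<in> topspace (top_of_set X) \<rightarrow> topspace (small_sets (2 * \<epsilon> n) (A n))"
      using rep_in [OF n] eps_pos [OF n] by (auto simp: topspace_small_sets)
    fix U
    show "openin (top_of_set X) {x \<in> topspace (top_of_set X). {rep n x} \<in> U}"
      unfolding openin_euclidean_subtopology_iff
    proof (intro conjI ballI)
      fix x assume x: "x \<in> {x \<in> topspace (top_of_set X). {rep n x} \<in> U}"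
      have "rep n y = rep n x" if "y \<in> X" "dist y x < \<epsilon> n" for y
        using representative_eq [OF ultrametric transversal [OF n] that(1) _ that(2)] x by simp
      then have "\<forall>y\<in>X. dist y x < \<epsilon> n \<longrightarrow>
          y \<in> {x \<in> topspace (top_of_set X). {rep n x} \<in> U}"
        using x by simp
      then show "\<exists>e>0. \<forall>y\<in>X. dist y x < e \<longrightarrow>
          y \<in> {x \<in> topspace (top_of_set X). {rep n x} \<in> U}"
        using eps_pos [OF n] by blast
    qed simp
  qed
  have "continuous_map (top_of_set X)
      (product_topology (\<lambda>n. small_sets (2 * \<epsilon> n) (A n)) {1..}) thread_of"
    unfolding continuous_map_componentwise
    using coord by (auto simp: thread_of_def)
  moreover have "thread_of \<in> topspace (top_of_set X) \<rightarrow>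
      {C. \<forall>n\<ge>1. nearest_map (A n) (C (Suc n)) = C n}"
    using thread_of_in unfolding topspace_FAS_inverse_limit by auto
  ultimately show ?thesis
    unfolding FAS_inverse_limit_def by (rule continuous_map_into_subtopology)
qed

lemma inj_on_thread_of: "inj_on thread_of X"
proof (rule inj_onI)
  fix x y assume xy: "x \<in> X" "y \<in> X" "thread_of x = thread_of y"
  show "x = y"
  proof (rule ccontr)
    assume "x \<noteq> y"
    then have "0 < dist x y" by simp
    then have "\<forall>\<^sub>F n in sequentially. \<epsilon> n < dist x y"
      using eps_tendsto by (rule order_tendstoD(2) [rotated])
    then have "\<forall>\<^sub>F n in sequentially. \<epsilon> n < dist x y \<and> 1 \<le> n"
      by (intro eventually_conj eventually_ge_at_top)
    then obtain n where n: "\<epsilon> n < dist x y" "1 \<le> n"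
      using eventually_happens' [OF sequentially_bot] by blast
    have "thread_of x n = thread_of y n"
      using xy(3) by simp
    then have eq: "rep n x = rep n y"
      using n(2) by (simp add: thread_of_def)
    have "dist (rep n x) y < \<epsilon> n"
      using dist_rep [OF n(2) xy(2)] eq by (simp add: dist_commute)
    then have "dist x y < \<epsilon> n"
      using ultrametric_on_dist_less [OF ultrametric xy(1) _ xy(2) dist_rep [OF n(2) xy(1)]]
        rep_in [OF n(2) xy(1)] A_subset [OF n(2)] by blast
    then show False
      using n(1) by simp
  qed
qed

text \<open>A thread determines nested balls of radius \<open>\<epsilon> n\<close>; compactness supplies their common point.
  Since these balls are clopen, the limit of their centres still lies in each of them.\<close>

lemma thread_of_surj:
  assumes "C \<in> topspace (FAS_inverse_limit \<epsilon> A)"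
  shows "C \<in> thread_of ` X"
proof -
  obtain a where a: "\<And>n. 1 \<le> n \<Longrightarrow> C n = {a n}" "\<And>n. 1 \<le> n \<Longrightarrow> a n \<in> A n"
    "\<And>n. 1 \<le> n \<Longrightarrow> a n = rep n (a (Suc n))"
    using thread_points [OF assms] by metis
  have aX: "a n \<in> X" if "1 \<le> n" for n
    using a(2) A_subset that by blast
  have near: "dist (a m) (a n) < \<epsilon> n" if "1 \<le> n" "n \<le> m" for m n
    using that(2)
  proof (induction m rule: dec_induct)
    case base
    then show ?case using eps_pos [OF that(1)] by simp
  next
    case (step m)
    then have m: "1 \<le> m" using that(1) by simp
    have "dist (a (Suc m)) (a m) < \<epsilon> m"
      using a(3) [OF m] dist_rep [OF m, of "a (Suc m)"] aX [of "Suc m"] by simp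
    then have "dist (a (Suc m)) (a m) < \<epsilon> n"
      using eps_antimono [OF that(1) step(1)] by simp
    then show ?case
      using ultrametric_on_dist_less [OF ultrametric _ _ _ _ step(3)] aX [OF m]
        aX [of "Suc m"] aX [OF that(1)] by simp
  qed
  have "\<forall>n. a (Suc n) \<in> X"
    using aX by simp
  then obtain x s where x: "x \<in> X" "strict_mono s" "((\<lambda>n. a (Suc n)) \<circ> s) \<longlonglongrightarrow> x"
    using compact unfolding compact_def by metis
  have "rep n x = a n" if n: "1 \<le> n" for n
  proof (rule representative_unique [OF transversal [OF n] x(1) a(2) [OF n]])
    have "\<forall>\<^sub>F k in sequentially. dist (((\<lambda>n. a (Suc n)) \<circ> s) k) x < \<epsilon> n"
      using x(3) eps_pos [OF n] by (rule tendstoD)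
    then have "\<forall>\<^sub>F k in sequentially. dist (a (Suc (s k))) x < \<epsilon> n \<and> n \<le> k"
      by (intro eventually_conj eventually_ge_at_top) simp
    then obtain k where k: "dist (a (Suc (s k))) x < \<epsilon> n" "n \<le> k"
      using eventually_happens' [OF sequentially_bot] by blast
    then have "n \<le> Suc (s k)"
      using seq_suble [OF x(2), of k] by simp
    then have "dist (a (Suc (s k))) (a n) < \<epsilon> n"
      using near n by blast
    then show "dist x (a n) < \<epsilon> n"
      using ultrametric_on_dist_less [OF ultrametric x(1), of "a (Suc (s k))" "a n"] k(1)
        aX [of "Suc (s k)"] aX [OF n]
      by (simp add: dist_commute)
  qed
  then have "thread_of x n = C n" if "1 \<le> n" for n
    using a(1) that by (simp add: thread_of_def)
  moreover have "C \<in> extensional {1..}"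
    using assms by (rule thread_extensional)
  ultimately have "thread_of x = C"
    unfolding thread_of_def by (intro extensionalityI [of _ "{1..}"]) simp_all
  then show ?thesis
    using x(1) by blast
qed

text \<open>Although the individual spaces need not even be \<open>T\<^sub>1\<close>, distinct threads differ at some
  index, where both are singletons and hence isolated.\<close>

lemma Hausdorff_FAS_inverse_limit: "Hausdorff_space (FAS_inverse_limit \<epsilon> A)"
  unfolding Hausdorff_space_def
proof (intro allI impI)
  let ?L = "FAS_inverse_limit \<epsilon> A"
  fix C D assume CD: "C \<in> topspace ?L \<and> D \<in> topspace ?L \<and> C \<noteq> D"
  then have "C \<in> extensional {1..}" "D \<in> extensional {1..}"
    using thread_extensional by blast+
  then obtain n where n: "1 \<le> n" "C n \<noteq> D n"
    using CD extensionalityI [of C "{1..}" D] by (metis atLeast_iff)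
  define V where "V E = {T \<in> topspace ?L. T n \<in> {E n}}" for E :: "nat \<Rightarrow> 'a set"
  have "openin ?L (V E)" if E: "E \<in> topspace ?L" for E
  proof -
    obtain a where a: "E n = {a}" "a \<in> A n"
      using thread_points [OF E] n(1) by metis
    then have "openin (small_sets (2 * \<epsilon> n) (A n)) {E n}"
      using openin_small_sets_singleton [OF a(2)] eps_pos [OF n(1)] by simp
    then show ?thesis
      unfolding V_def
      by (rule openin_continuous_map_preimage [OF continuous_map_FAS_coordinate [OF n(1)]])
  qed
  moreover have "C \<in> V C" "D \<in> V D" "disjnt (V C) (V D)"
    using CD n(2) unfolding V_def disjnt_iff by simp_all
  ultimately show "\<exists>U V. openin ?L U \<and> openin ?L V \<and> C \<in> U \<and> D \<in> V \<and> disjnt U V"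
    using CD by blast
qed

lemma FAS_inverse_limit_homeomorphic:
  "FAS_inverse_limit \<epsilon> A homeomorphic_space top_of_set X"
proof -
  have "homeomorphic_map (top_of_set X) (FAS_inverse_limit \<epsilon> A) thread_of"
  proof (rule continuous_imp_homeomorphic_map)
    show "compact_space (top_of_set X)"
      using compact by (simp add: compact_space_subtopology)
    show "thread_of ` topspace (top_of_set X) = topspace (FAS_inverse_limit \<epsilon> A)"
      using thread_of_in thread_of_surj by auto
  qed (simp_all add: continuous_map_thread_of Hausdorff_FAS_inverse_limit inj_on_thread_of)
  then show ?thesis
    using homeomorphic_map_imp_homeomorphic_space homeomorphic_space_sym by blast
qed

end

section \<open>Existence of the sequence\<close>

theorem theorem7:
  fixes X :: "'a::metric_space set"
  assumes "compact X" and "ultrametric_on X"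
  shows "\<exists>(\<epsilon> :: nat \<Rightarrow> real) (A :: nat \<Rightarrow> 'a set).
           finite_approximative_sequence X \<epsilon> A \<and>
           FAS_inverse_limit \<epsilon> A homeomorphic_space top_of_set X"
proof -
  obtain T where T: "\<And>\<delta>. 0 < \<delta> \<Longrightarrow> ball_transversal X \<delta> (T \<delta>)"
    using ball_transversal_exists [OF assms] by metis
  \<comment> \<open>Any positive factor below \<open>1/2\<close> makes the next number adjusted and forces convergence to 0.\<close>
  define \<epsilon> where "\<epsilon> = rec_nat 1 (\<lambda>_ \<delta>. (\<delta> - covering_radius X (T \<delta>)) / 4)"
  define A where "A n = T (\<epsilon> n)" for n
  have eps0: "\<epsilon> 0 = 1"
    and epsSuc: "\<epsilon> (Suc n) = (\<epsilon> n - covering_radius X (A n)) / 4" for n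
    unfolding \<epsilon>_def A_def by simp_all
  have radius: "covering_radius X (T \<delta>) < \<delta>" if "0 < \<delta>" for \<delta>
    using covering_radius_less [OF assms(1) ball_transversal_finite_approximation [OF T]] that
    by blast
  have pos: "0 < \<epsilon> n" for n
  proof (induction n)
    case (Suc n)
    then show ?case
      using radius [of "\<epsilon> n"] by (simp add: epsSuc A_def)
  qed (simp add: eps0)
  have quarter: "\<epsilon> (Suc n) \<le> \<epsilon> n / 4" for n
    using covering_radius_nonneg [OF assms(1), of "A n"] by (simp add: epsSuc)
  have bound: "\<epsilon> n \<le> (1/4) ^ n" for n
  proof (induction n)
    case (Suc n)
    then show ?case using quarter [of n] by simp
  qed (simp add: eps0)
  have "(\<lambda>n. (1/4::real) ^ n) \<longlonglongrightarrow> 0"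
    by (rule LIMSEQ_realpow_zero) auto
  then have lim: "\<epsilon> \<longlonglongrightarrow> 0"
    using pos bound by (intro tendsto_sandwich [of "\<lambda>_. 0" \<epsilon> sequentially "\<lambda>n. (1/4) ^ n"])
      (auto intro: always_eventually less_imp_le)
  have trans: "ball_transversal X (\<epsilon> n) (A n)" for n
    unfolding A_def using T pos by blast
  have "adjusted X (\<epsilon> n) (A n) (\<epsilon> (Suc n))" for n
    using pos [of n] pos [of "Suc n"] quarter [of n] epsSuc [of n]
    unfolding adjusted_def by linarith
  then have FAS: "finite_approximative_sequence X \<epsilon> A"
    unfolding finite_approximative_sequence_def
    using pos lim trans ball_transversal_finite_approximation by blast
  interpret transversal_sequence X \<epsilon> A
    using assms FAS trans by unfold_locales
  show ?thesis
    using FAS FAS_inverse_limit_homeomorphic by blast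
qed

end
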